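(* Consider an instance of the six-vertex model with the constraint function $f^*$ (with parameter $b>0$) whose underlying graph is two-by-two-intersection free, with circuit decomposition $\mathcal{C}$, $n=|\mathcal{C}|$ and $\delta=\max_{C_i\in\mathcal{C}}|\Gamma(C_i)|$. Suppose $\delta\ge 2$ and $b\le\frac{1}{\delta}$. Then the Markov chain $\{Z_t\}$ (defined in the context) mixes in time $$\tau(\varepsilon)=O\left(\frac{n(1+b^{\delta})}{b^{\delta}+1-b\delta}\,\log\left(\frac{n\delta}{\varepsilon}\right)\right)$$ for $\varepsilon\in(0,1)$, where the implied constant is absolute.
   Context: The model. Let $b>0$ be rational and let $f^*:\{0,1\}^4\to\mathbb{Q}_{\ge 0}$ be given by $f^*(0,0,1,1)=1$, $f^*(0,1,1,0)=f^*(1,0,0,1)=b$, and $f^*=0$ on all other inputs. Let $G=(V,E)$ be a finite 4-regular graph and let $G'=(U_E,U_V,E')$ be its edge-vertex incidence graph. Each degree-2 vertex of $G'$ (in $U_E$) is labelled with the binary disequality function $\neq_2$ (value 1 on inputs 01, 10 and 0 on 00, 11), and each degree-4 vertex of $G'$ (in $U_V$) is labelled with $f^*$, its four incident edges being identified with the variables $x_1,x_2,x_3,x_4$. A valid configuration is an assignment $E'\to\{0,1\}$ for which the product of the values of all vertex functions is non-zero; $\Omega$ is the set of all valid configurations. $G'$ is the underlying graph. Circuit decomposition. At each degree-4 vertex pair the variables as $(x_1,x_3)$ and $(x_2,x_4)$. Partition the edges of $G'$ into circuits by following paths that cross degree-2 vertices directly and, at a degree-4 vertex, leave by the edge paired with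 the edge of entry, until the path returns to its starting point and closes up; remove the circuit and repeat until no edges remain. The resulting set of circuits is $\mathcal{C}$, with $n=|\mathcal{C}|$. In a valid configuration the edges along each circuit take the values 0 and 1 alternately. For each circuit $C_i$ fix an initial edge $e_i$ which corresponds to a variable $x_1$ or $x_2$; the value $\sigma(C_i)\in\{0,1\}$ of the circuit in a configuration $\sigma$ is the value of $e_i$, and a configuration is thereby identified with a 0-1 string indexed by $\mathcal{C}$. Two distinct circuits are neighbors if they share a common vertex. $\Gamma(C_i)$ is the set of neighbors of $C_i$, $\delta_{C_i}=|\Gamma(C_i)|$ and $\delta=\max_{C_i\in\mathcal{C}}\delta_{C_i}$. The underlying graph is two-by-two-intersection free if no three circuits of $\mathcal{C}$ intersect one another pairwise (i.e. there are no three distinct circuits that are pairwise neighbors). Standing identification: a 0-1 string $\sigma$ indexed by $\mathcal{C}$ is a valid configuration exactly when no two neighboring circuits both take the value 1 in $\sigma$. The Markov chain $\{Z_t\}$ on $\Omega$. From state $\sigma\in\Omega$: choose a circuit $C_i\in\mathcal{C}$ uniformly at random; let $\sigma'$ be obtained from $\sigma$ by setting only the value of $C_i$ to 1 with probability $\frac{b^{\delta_{C_i}}}{1+b^{\delta_{C_i}}}$, and by setting only the value of $C_i$ to 0 with probability $\frac{1}{1+b^{\delta_{C_i}}}$; if $\sigma'$ is a valid configuration move to $\sigma'$, otherwise remain at $\sigma$. Let $P$ be its transition matrix and $\pi$ its unique stationary distribution, which is $\pi(\sigma)=\prod_{C_i:\sigma(C_i)=1}b^{\delta_{C_i}}\Big/\sum_{\eta\in\Omega}\prod_{C_i:\eta(C_i)=1}b^{\delta_{C_i}}$.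 Mixing time. $\Delta_i(t)=\frac12\sum_{\sigma_j\in\Omega}|P^t_{ij}-\pi_j|$ is the total variation distance to stationarity after $t$ steps from initial state $\sigma_i$, and $\tau(\varepsilon)=\max_i\min\{t:\Delta_i(t')\le\varepsilon\text{ for all }t'\ge t\}$. *)

theory Defs
  imports "HOL-Probability.Probability"
begin

section \<open>Six-vertex instances\<close>

datatype var = X1 | X2 | X3 | X4

text \<open>
  A 4-regular (multi)graph \<open>G = (V, E)\<close>, loops and parallel edges allowed, together with the
  identification of the four incident edges at every vertex with the variables
  \<open>x\<^sub>1, \<dots>, x\<^sub>4\<close>: \<open>attach I (v, x)\<close> is the edge of \<open>G\<close> that occupies variable \<open>x\<close> at \<open>v\<close>.
  The pairs \<open>(v, x)\<close> are exactly the edges of the edge-vertex incidence graph \<open>G'\<close>; the pair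
  \<open>(v, x)\<close> joins the degree-4 vertex \<open>v\<close> to the degree-2 vertex \<open>attach I (v, x)\<close>.
\<close>

record ('v, 'e) six_vertex =
  verts :: "'v set"
  edges :: "'e set"
  attach :: "'v \<times> var \<Rightarrow> 'e"

definition inc_edges :: "('v, 'e) six_vertex \<Rightarrow> ('v \<times> var) set" where
  "inc_edges I = verts I \<times> UNIV"

definition six_vertex_instance :: "('v, 'e) six_vertex \<Rightarrow> bool" where
  "six_vertex_instance I \<longleftrightarrow>
     finite (verts I) \<and> verts I \<noteq> {} \<and> finite (edges I) \<and>
     attach I \<in> inc_edges I \<rightarrow> edges I \<and>
     (\<forall>e\<in>edges I. card {h \<in> inc_edges I. attach I h = e} = 2)"

text \<open>The mate of an edge of \<open>G'\<close> across its degree-2 endpoint and across its degree-4 endpoint.\<close>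

definition edge_mate :: "('v, 'e) six_vertex \<Rightarrow> 'v \<times> var \<Rightarrow> 'v \<times> var" where
  "edge_mate I h = (THE h'. h' \<in> inc_edges I \<and> h' \<noteq> h \<and> attach I h' = attach I h)"

fun paired_var :: "var \<Rightarrow> var" where
  "paired_var X1 = X3"
| "paired_var X3 = X1"
| "paired_var X2 = X4"
| "paired_var X4 = X2"

definition vertex_mate :: "'v \<times> var \<Rightarrow> 'v \<times> var" where
  "vertex_mate h = (fst h, paired_var (snd h))"


section \<open>Valid configurations\<close>

definition disequality :: "bool \<Rightarrow> bool \<Rightarrow> rat" where
  "disequality x y = (if x \<noteq> y then 1 else 0)"

definition f_star :: "rat \<Rightarrow> bool \<Rightarrow> bool \<Rightarrow> bool \<Rightarrow> bool \<Rightarrow> rat" where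
  "f_star b x1 x2 x3 x4 =
     (if (x1, x2, x3, x4) = (False, False, True, True) then 1
      else if (x1, x2, x3, x4) = (False, True, True, False) then b
      else if (x1, x2, x3, x4) = (True, False, False, True) then b
      else 0)"

text \<open>Disequality is symmetric, so it is immaterial which of the two edges at \<open>e\<close> is chosen.\<close>

definition edge_factor :: "('v, 'e) six_vertex \<Rightarrow> ('v \<times> var \<Rightarrow> bool) \<Rightarrow> 'e \<Rightarrow> rat" where
  "edge_factor I \<sigma> e =
     (let h = (SOME h. h \<in> inc_edges I \<and> attach I h = e)
      in disequality (\<sigma> h) (\<sigma> (edge_mate I h)))"

definition vertex_factor :: "rat \<Rightarrow> ('v \<times> var \<Rightarrow> bool) \<Rightarrow> 'v \<Rightarrow> rat" where
  "vertex_factor b \<sigma> v = f_star b (\<sigma> (v, X1)) (\<sigma> (v, X2)) (\<sigma> (v, X3)) (\<sigma> (v, X4))"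

definition valid_configurations :: "('v, 'e) six_vertex \<Rightarrow> rat \<Rightarrow> ('v \<times> var \<Rightarrow> bool) set" where
  "valid_configurations I b =
     {\<sigma> \<in> inc_edges I \<rightarrow>\<^sub>E UNIV.
        (\<Prod>e\<in>edges I. edge_factor I \<sigma> e) * (\<Prod>v\<in>verts I. vertex_factor b \<sigma> v) \<noteq> 0}"


section \<open>Circuit decomposition\<close>

text \<open>
  \<open>follow I h\<close> is the path starting with \<open>h\<close> that crosses degree-2 and degree-4 vertices in turn.
  Both mate functions are involutions, so it is periodic and its range is the closed circuit
  through \<open>h\<close>.  Distinct circuits are disjoint (lemma \<open>circuit_of_eq\<close>), so removing a traced
  circuit does not affect the tracing of the others.
\<close>

primrec follow :: "('v, 'e) six_vertex \<Rightarrow> 'v \<times> var \<Rightarrow> nat \<Rightarrow> 'v \<times> var" where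
  "follow I h 0 = h"
| "follow I h (Suc k) =
     (if even k then edge_mate I (follow I h k) else vertex_mate (follow I h k))"

definition circuit_of :: "('v, 'e) six_vertex \<Rightarrow> 'v \<times> var \<Rightarrow> ('v \<times> var) set" where
  "circuit_of I h = range (follow I h)"

definition circuits :: "('v, 'e) six_vertex \<Rightarrow> ('v \<times> var) set set" where
  "circuits I = circuit_of I ` inc_edges I"

text \<open>
  A circuit contains both edges at every degree-2 vertex it meets, so a common vertex of distinct
  circuits is a degree-4 one.
\<close>

definition neighbor ::
    "('v, 'e) six_vertex \<Rightarrow> ('v \<times> var) set \<Rightarrow> ('v \<times> var) set \<Rightarrow> bool" where
  "neighbor I C D \<longleftrightarrow>
     C \<in> circuits I \<and> D \<in> circuits I \<and> C \<noteq> D \<and> fst ` C \<inter> fst ` D \<noteq> {}"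

definition Gam :: "('v, 'e) six_vertex \<Rightarrow> ('v \<times> var) set \<Rightarrow> ('v \<times> var) set set" where
  "Gam I C = {D. neighbor I C D}"

definition circuit_degree :: "('v, 'e) six_vertex \<Rightarrow> ('v \<times> var) set \<Rightarrow> nat" where
  "circuit_degree I C = card (Gam I C)"

definition max_circuit_degree :: "('v, 'e) six_vertex \<Rightarrow> nat" where
  "max_circuit_degree I = Max (circuit_degree I ` circuits I)"

definition two_by_two_intersection_free :: "('v, 'e) six_vertex \<Rightarrow> bool" where
  "two_by_two_intersection_free I \<longleftrightarrow>
     \<not> (\<exists>C D F. neighbor I C D \<and> neighbor I D F \<and> neighbor I C F)"


section \<open>Configurations as 0-1 strings\<close>

type_synonym 'v circuit_string = "('v \<times> var) set \<Rightarrow> bool"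

definition initial_edges ::
    "('v, 'e) six_vertex \<Rightarrow> (('v \<times> var) set \<Rightarrow> 'v \<times> var) \<Rightarrow> bool" where
  "initial_edges I ini \<longleftrightarrow> (\<forall>C\<in>circuits I. ini C \<in> C \<and> snd (ini C) \<in> {X1, X2})"

definition string_of ::
    "('v, 'e) six_vertex \<Rightarrow> (('v \<times> var) set \<Rightarrow> 'v \<times> var) \<Rightarrow> ('v \<times> var \<Rightarrow> bool)
      \<Rightarrow> 'v circuit_string" where
  "string_of I ini \<sigma> = (\<lambda>C\<in>circuits I. \<sigma> (ini C))"

text \<open>
  The state space: valid configurations, written as strings.  A valid configuration is determined
  by its string (lemma \<open>inj_on_string_of\<close>).
\<close>

definition \<Omega> ::
    "('v, 'e) six_vertex \<Rightarrow> rat \<Rightarrow> (('v \<times> var) set \<Rightarrow> 'v \<times> var) \<Rightarrow> 'v circuit_string set" where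
  "\<Omega> I b ini = string_of I ini ` valid_configurations I b"

text \<open>
  The standing identification is a condition on the instance and on the choice of initial edges:
  if a circuit is entered through \<open>x\<^sub>1\<close> at one vertex and left through \<open>x\<^sub>1\<close> at another, its value
  alone does not give the value of \<open>x\<^sub>1\<close> at both.
\<close>

definition standing_identification ::
    "('v, 'e) six_vertex \<Rightarrow> rat \<Rightarrow> (('v \<times> var) set \<Rightarrow> 'v \<times> var) \<Rightarrow> bool" where
  "standing_identification I b ini \<longleftrightarrow>
     (\<forall>s \<in> circuits I \<rightarrow>\<^sub>E UNIV. s \<in> \<Omega> I b ini \<longleftrightarrow> \<not> (\<exists>C D. neighbor I C D \<and> s C \<and> s D))"


section \<open>The Markov chain and its mixing time\<close>

definition circuit_weight :: "('v, 'e) six_vertex \<Rightarrow> rat \<Rightarrow> ('v \<times> var) set \<Rightarrow> real" where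
  "circuit_weight I b C = real_of_rat b ^ circuit_degree I C"

definition step ::
    "('v, 'e) six_vertex \<Rightarrow> rat \<Rightarrow> (('v \<times> var) set \<Rightarrow> 'v \<times> var) \<Rightarrow> 'v circuit_string
      \<Rightarrow> 'v circuit_string pmf" where
  "step I b ini s =
     bind_pmf (pmf_of_set (circuits I)) (\<lambda>C.
     bind_pmf (bernoulli_pmf (circuit_weight I b C / (1 + circuit_weight I b C))) (\<lambda>x.
     return_pmf (if s(C := x) \<in> \<Omega> I b ini then s(C := x) else s)))"

primrec steps ::
    "('v, 'e) six_vertex \<Rightarrow> rat \<Rightarrow> (('v \<times> var) set \<Rightarrow> 'v \<times> var) \<Rightarrow> nat \<Rightarrow> 'v circuit_string
      \<Rightarrow> 'v circuit_string pmf" where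
  "steps I b ini 0 s = return_pmf s"
| "steps I b ini (Suc t) s = bind_pmf (steps I b ini t s) (step I b ini)"

definition string_weight :: "('v, 'e) six_vertex \<Rightarrow> rat \<Rightarrow> 'v circuit_string \<Rightarrow> real" where
  "string_weight I b s = (\<Prod>C | C \<in> circuits I \<and> s C. circuit_weight I b C)"

definition stationary ::
    "('v, 'e) six_vertex \<Rightarrow> rat \<Rightarrow> (('v \<times> var) set \<Rightarrow> 'v \<times> var) \<Rightarrow> 'v circuit_string \<Rightarrow> real" where
  "stationary I b ini s = string_weight I b s / (\<Sum>u\<in>\<Omega> I b ini. string_weight I b u)"

definition tv_dist ::
    "('v, 'e) six_vertex \<Rightarrow> rat \<Rightarrow> (('v \<times> var) set \<Rightarrow> 'v \<times> var) \<Rightarrow> 'v circuit_string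
      \<Rightarrow> nat \<Rightarrow> real" where
  "tv_dist I b ini s t =
     1 / 2 * (\<Sum>u\<in>\<Omega> I b ini. \<bar>pmf (steps I b ini t s) u - stationary I b ini u\<bar>)"

text \<open>In \<open>enat\<close> the infimum of a nonempty set is its minimum and that of the empty set is \<open>\<infinity>\<close>.\<close>

definition mixing_time ::
    "('v, 'e) six_vertex \<Rightarrow> rat \<Rightarrow> (('v \<times> var) set \<Rightarrow> 'v \<times> var) \<Rightarrow> real \<Rightarrow> enat" where
  "mixing_time I b ini \<epsilon> =
     Max ((\<lambda>s. INF t \<in> {t. \<forall>t'\<ge>t. tv_dist I b ini s t' \<le> \<epsilon>}. enat t) ` \<Omega> I b ini)"


section \<open>Consistency of the encoding\<close>

lemma edge_mate_unique:
  assumes "six_vertex_instance I" "h \<in> inc_edges I"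
  shows "\<exists>!h'. h' \<in> inc_edges I \<and> h' \<noteq> h \<and> attach I h' = attach I h"
proof -
  have "attach I h \<in> edges I"
    using assms by (auto simp: six_vertex_instance_def)
  then have "card {k \<in> inc_edges I. attach I k = attach I h} = 2"
    using assms by (auto simp: six_vertex_instance_def)
  then obtain x y where xy: "{k \<in> inc_edges I. attach I k = attach I h} = {x, y}" "x \<noteq> y"
    unfolding card_2_iff by blast
  define z where "z = (if h = x then y else x)"
  have "h \<in> {x, y}"
    unfolding xy(1)[symmetric] using assms(2) by simp
  then have S: "{k \<in> inc_edges I. attach I k = attach I h} = {h, z}" and "z \<noteq> h"
    using xy by (auto simp: z_def)
  have mem: "k \<in> inc_edges I \<and> attach I k = attach I h \<longleftrightarrow> k = h \<or> k = z" for k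
    using eqset_imp_iff[OF S, of k] by simp
  show ?thesis
  proof (rule ex1I[of _ z])
    show "z \<in> inc_edges I \<and> z \<noteq> h \<and> attach I z = attach I h"
      using mem[of z] \<open>z \<noteq> h\<close> by simp
  next
    fix k assume "k \<in> inc_edges I \<and> k \<noteq> h \<and> attach I k = attach I h"
    then show "k = z" using mem[of k] by simp
  qed
qed

lemma edge_mate:
  assumes "six_vertex_instance I" "h \<in> inc_edges I"
  shows "edge_mate I h \<in> inc_edges I" "edge_mate I h \<noteq> h"
    "attach I (edge_mate I h) = attach I h"
  using theI'[OF edge_mate_unique[OF assms]] unfolding edge_mate_def by auto

lemma edge_mate_eqI:
  assumes "six_vertex_instance I" "h \<in> inc_edges I"
    and "h' \<in> inc_edges I" "h' \<noteq> h" "attach I h' = attach I h"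
  shows "edge_mate I h = h'"
  using edge_mate_unique[OF assms(1,2)] edge_mate[OF assms(1,2)] assms(3-) by blast

lemma edge_mate_edge_mate:
  assumes "six_vertex_instance I" "h \<in> inc_edges I"
  shows "edge_mate I (edge_mate I h) = h"
  by (rule edge_mate_eqI) (use assms edge_mate[OF assms] in auto)

lemma vertex_mate_vertex_mate [simp]: "vertex_mate (vertex_mate h) = h"
  by (cases h; cases "snd h") (auto simp: vertex_mate_def)

lemma vertex_mate_in [simp]: "vertex_mate h \<in> inc_edges I \<longleftrightarrow> h \<in> inc_edges I"
  by (auto simp: vertex_mate_def inc_edges_def mem_Times_iff)

lemma finite_inc_edges:
  assumes "six_vertex_instance I"
  shows "finite (inc_edges I)"
proof -
  have "x \<in> {X1, X2, X3, X4}" for x by (cases x) auto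
  then have "finite (UNIV :: var set)" by (intro finite_subset[of UNIV "{X1, X2, X3, X4}"]) auto
  with assms show ?thesis by (auto simp: six_vertex_instance_def inc_edges_def)
qed

lemma follow_in:
  assumes "six_vertex_instance I" "h \<in> inc_edges I"
  shows "follow I h k \<in> inc_edges I"
  by (induction k) (simp_all add: assms edge_mate(1))

lemma circuit_of_closed:
  assumes I: "six_vertex_instance I" and h: "h \<in> inc_edges I" and k: "k \<in> circuit_of I h"
  shows "edge_mate I k \<in> circuit_of I h" "vertex_mate k \<in> circuit_of I h"
proof -
  define F where "F = vertex_mate \<circ> edge_mate I"
  have even_step: "follow I h (2 * m) = (F ^^ m) h" for m
    by (induction m) (auto simp: F_def)
  have inF: "F x \<in> inc_edges I" if "x \<in> inc_edges I" for x
    using that edge_mate[OF I that] by (auto simp: F_def)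
  have injF: "inj_on F (inc_edges I)"
    by (rule inj_on_inverseI[where g = "edge_mate I \<circ> vertex_mate"])
      (auto simp: F_def edge_mate_edge_mate[OF I])
  have pow_in: "(F ^^ m) h \<in> inc_edges I" for m
    using follow_in[OF I h, of "2 * m"] even_step by simp
  have "finite (range (\<lambda>m. (F ^^ m) h))"
    by (rule finite_subset[OF _ finite_inc_edges[OF I]]) (use pow_in in auto)
  then have "\<not> inj (\<lambda>m. (F ^^ m) h)"
    using range_inj_infinite by blast
  then obtain i j where "i \<noteq> j" "(F ^^ i) h = (F ^^ j) h"
    by (auto simp: inj_def)
  then obtain i j where ij: "i < j" "(F ^^ i) h = (F ^^ j) h"
    by (cases i j rule: linorder_cases) auto
  have "(F ^^ (j - i)) h = h"
    using ij
  proof (induction i arbitrary: j)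
    case (Suc i)
    then obtain j' where j': "j = Suc j'" by (cases j) auto
    have "F ((F ^^ i) h) = F ((F ^^ j') h)"
      using Suc.prems(2) j' by simp
    then have "(F ^^ i) h = (F ^^ j') h"
      by (rule inj_onD[OF injF _ pow_in pow_in])
    with Suc.IH[of j'] Suc.prems j' show ?case by simp
  qed simp
  moreover obtain p where "j - i = Suc p"
    using ij(1) by (cases "j - i") auto
  ultimately have "(F ^^ Suc p) h = h"
    by simp
  then have "vertex_mate (edge_mate I ((F ^^ p) h)) = h"
    by (simp add: F_def)
  from arg_cong[OF this, of vertex_mate] have "vertex_mate h = edge_mate I ((F ^^ p) h)"
    by simp
  also have "\<dots> = follow I h (Suc (2 * p))"
    using even_step by simp
  finally have start: "vertex_mate h \<in> circuit_of I h"
    unfolding circuit_of_def by (metis rangeI)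
  from k obtain q where q: "k = follow I h q" by (auto simp: circuit_of_def)
  show "edge_mate I k \<in> circuit_of I h"
  proof (cases "even q")
    case True
    then have "edge_mate I k = follow I h (Suc q)" using q by simp
    then show ?thesis unfolding circuit_of_def by (metis rangeI)
  next
    case False
    then obtain r where r: "q = Suc r" "even r"
      by (cases q) auto
    then have "edge_mate I k = follow I h r"
      using q edge_mate_edge_mate[OF I follow_in[OF I h]] by simp
    then show ?thesis unfolding circuit_of_def by (metis rangeI)
  qed
  show "vertex_mate k \<in> circuit_of I h"
  proof (cases "odd q")
    case True
    then have "vertex_mate k = follow I h (Suc q)" using q by simp
    then show ?thesis unfolding circuit_of_def by (metis rangeI)
  next
    case False
    show ?thesis
    proof (cases q)
      case 0
      then show ?thesis using q start by simp
    next
      case (Suc r)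
      then have "vertex_mate k = follow I h r"
        using q False by simp
      then show ?thesis unfolding circuit_of_def by (metis rangeI)
    qed
  qed
qed

lemma circuit_of_subset:
  assumes I: "six_vertex_instance I" and h: "h \<in> inc_edges I" and k: "k \<in> circuit_of I h"
  shows "circuit_of I k \<subseteq> circuit_of I h"
proof -
  have "follow I k m \<in> circuit_of I h" for m
    by (induction m) (auto simp: k intro: circuit_of_closed[OF I h])
  then show ?thesis by (auto simp: circuit_of_def)
qed

lemma self_in_circuit_of: "h \<in> circuit_of I h"
  unfolding circuit_of_def by (metis rangeI follow.simps(1))

lemma circuit_of_eq:
  assumes I: "six_vertex_instance I" and h: "h \<in> inc_edges I" and k: "k \<in> circuit_of I h"
  shows "circuit_of I k = circuit_of I h"
proof
  show "circuit_of I k \<subseteq> circuit_of I h" by (rule circuit_of_subset[OF assms])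
  have k_in: "k \<in> inc_edges I" using k follow_in[OF I h] by (auto simp: circuit_of_def)
  have reach: "h \<in> circuit_of I k" if "follow I h m \<in> circuit_of I k" for m
    using that
  proof (induction m)
    case (Suc m)
    have "follow I h m \<in> {edge_mate I (follow I h (Suc m)), vertex_mate (follow I h (Suc m))}"
      using edge_mate_edge_mate[OF I follow_in[OF I h, of m]] by simp
    moreover note circuit_of_closed[OF I k_in Suc.prems]
    ultimately have "follow I h m \<in> circuit_of I k"
      by (metis insert_iff singletonD)
    then show ?case by (rule Suc.IH)
  qed simp
  from k have "h \<in> circuit_of I k"
    using reach self_in_circuit_of by (metis circuit_of_def imageE)
  then show "circuit_of I h \<subseteq> circuit_of I k"
    by (rule circuit_of_subset[OF I k_in])
qed

lemma valid_alternates: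
  assumes I: "six_vertex_instance I" and \<sigma>: "\<sigma> \<in> valid_configurations I b" and h: "h \<in> inc_edges I"
  shows "\<sigma> (edge_mate I h) \<longleftrightarrow> \<not> \<sigma> h" "\<sigma> (vertex_mate h) \<longleftrightarrow> \<not> \<sigma> h"
proof -
  have fin: "finite (edges I)" "finite (verts I)" and e: "attach I h \<in> edges I"
    using I h by (auto simp: six_vertex_instance_def)
  have nz: "edge_factor I \<sigma> (attach I h) \<noteq> 0" "\<forall>v\<in>verts I. vertex_factor b \<sigma> v \<noteq> 0"
    using \<sigma> fin e by (auto simp: valid_configurations_def)
  define g where "g = (SOME k. k \<in> inc_edges I \<and> attach I k = attach I h)"
  have g: "g \<in> inc_edges I" "attach I g = attach I h"
    using someI[of "\<lambda>k. k \<in> inc_edges I \<and> attach I k = attach I h" h] h by (auto simp: g_def)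
  have ne: "\<sigma> (edge_mate I g) \<longleftrightarrow> \<not> \<sigma> g"
    using nz(1) by (auto simp: edge_factor_def g_def disequality_def Let_def split: if_splits)
  show "\<sigma> (edge_mate I h) \<longleftrightarrow> \<not> \<sigma> h"
  proof (cases "g = h")
    case False
    then have "edge_mate I h = g" "edge_mate I g = h"
      using edge_mate_eqI[OF I] g h by auto
    with ne show ?thesis by auto
  qed (use ne in simp)
  obtain v x where hv: "h = (v, x)" by (cases h)
  then have "vertex_factor b \<sigma> v \<noteq> 0" using nz(2) h by (auto simp: inc_edges_def)
  then show "\<sigma> (vertex_mate h) \<longleftrightarrow> \<not> \<sigma> h"
    by (cases x) (auto simp: hv vertex_mate_def vertex_factor_def f_star_def split: if_splits)
qed

lemma inj_on_string_of:
  assumes I: "six_vertex_instance I" and ini: "initial_edges I ini"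
  shows "inj_on (string_of I ini) (valid_configurations I b)"
proof (rule inj_onI)
  fix \<sigma> \<tau> assume \<sigma>: "\<sigma> \<in> valid_configurations I b" and \<tau>: "\<tau> \<in> valid_configurations I b"
    and eq: "string_of I ini \<sigma> = string_of I ini \<tau>"
  show "\<sigma> = \<tau>"
  proof (rule PiE_ext)
    show "\<sigma> \<in> inc_edges I \<rightarrow>\<^sub>E UNIV" "\<tau> \<in> inc_edges I \<rightarrow>\<^sub>E UNIV"
      using \<sigma> \<tau> by (auto simp: valid_configurations_def)
    fix h assume h: "h \<in> inc_edges I"
    define g where "g = ini (circuit_of I h)"
    have C: "circuit_of I h \<in> circuits I" using h by (auto simp: circuits_def)
    then have gC: "g \<in> circuit_of I h" using ini by (auto simp: initial_edges_def g_def)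
    then have g: "g \<in> inc_edges I" using follow_in[OF I h] by (auto simp: circuit_of_def)
    have start: "\<sigma> g = \<tau> g"
      using fun_cong[OF eq, of "circuit_of I h"] C by (simp add: string_of_def g_def)
    have along: "\<sigma> (follow I g m) = \<tau> (follow I g m)" for m
      by (induction m)
        (auto simp: start valid_alternates[OF I \<sigma> follow_in[OF I g]]
            valid_alternates[OF I \<tau> follow_in[OF I g]])
    have "h \<in> circuit_of I g"
      using circuit_of_eq[OF I h gC] self_in_circuit_of[of h I] by simp
    then show "\<sigma> h = \<tau> h" using along by (auto simp: circuit_of_def)
  qed
qed

end

theory Submission
  imports Defs
begin

text \<open>
  The chain is Glauber dynamics for the hard-core model on the graph of circuits, with fugacity
  \<open>b ^ \<delta>\<^sub>C\<close> at \<open>C\<close>. Run it from two states with the same choices of circuit and of new value. An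
  updated circuit is left in disagreement only if it is set to 1 and a disagreeing neighbor blocks
  it in exactly one of the states. A circuit with a neighbor is set to 1 with probability at most
  \<open>b / (1 + b) \<le> b / (1 + b ^ \<delta>)\<close>, so one step multiplies the expected number of disagreements by
  at most \<open>1 - (1 - \<delta> b / (1 + b ^ \<delta>)) / n\<close>. The
  contraction is expressed through Lipschitz constants of functions on the state space, which
  avoids constructing the coupling.
\<close>

section \<open>The states as independent sets of the graph of circuits\<close>

locale circuit_chain =
  fixes I :: "('v, 'e) six_vertex" and b :: rat and ini :: "('v \<times> var) set \<Rightarrow> 'v \<times> var"
  assumes I: "six_vertex_instance I"
    and b_pos: "b > 0"
    and ident: "standing_identification I b ini"
begin

abbreviation V where "V \<equiv> circuits I"
abbreviation S where "S \<equiv> \<Omega> I b ini"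
abbreviation wt where "wt \<equiv> circuit_weight I b"

definition up_prob :: "('v \<times> var) set \<Rightarrow> real" where
  "up_prob C = wt C / (1 + wt C)"

definition disagree :: "'v circuit_string \<Rightarrow> 'v circuit_string \<Rightarrow> ('v \<times> var) set set" where
  "disagree s u = {C \<in> V. s C \<noteq> u C}"

definition hamming :: "'v circuit_string \<Rightarrow> 'v circuit_string \<Rightarrow> real" where
  "hamming s u = real (card (disagree s u))"

abbreviation expect where "expect M f \<equiv> measure_pmf.expectation M f"

lemma finite_V: "finite V"
  using finite_inc_edges[OF I] by (simp add: circuits_def)

lemma V_nonempty: "V \<noteq> {}"
  using I by (auto simp: circuits_def inc_edges_def six_vertex_instance_def)

lemma card_V_pos: "card V > 0"
  using finite_V V_nonempty by (simp add: card_gt_0_iff)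

text \<open>\<open>string_of\<close> restricts to the set of circuits, so every state is
  extensional, and to extensional strings the standing identification applies. From here on a state
  is an independent set in the graph of circuits; the vertex and edge factors do not occur
  again.\<close>

lemma mem_S: "s \<in> S \<longleftrightarrow> s \<in> V \<rightarrow>\<^sub>E UNIV \<and> (\<forall>C D. neighbor I C D \<longrightarrow> s C \<longrightarrow> \<not> s D)"
proof -
  have "S \<subseteq> V \<rightarrow>\<^sub>E UNIV"
    by (auto simp: \<Omega>_def string_of_def)
  moreover have "s \<in> S \<longleftrightarrow> \<not> (\<exists>C D. neighbor I C D \<and> s C \<and> s D)" if "s \<in> V \<rightarrow>\<^sub>E UNIV"
    using ident that unfolding standing_identification_def by (rule bspec)
  moreover from calculation(1) have "s \<notin> S" if "s \<notin> V \<rightarrow>\<^sub>E UNIV"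
    using that by (rule contra_subsetD)
  ultimately show ?thesis
    by (cases "s \<in> V \<rightarrow>\<^sub>E UNIV") (simp_all only: simp_thms, blast)
qed

lemma finite_S: "finite S"
  by (rule finite_subset[of _ "V \<rightarrow>\<^sub>E (UNIV :: bool set)"])
    (auto simp: mem_S finite_V intro!: finite_PiE)

lemma S_nonempty: "S \<noteq> {}"
proof -
  have "(\<lambda>C\<in>V. False) \<in> S"
    by (auto simp: mem_S neighbor_def)
  then show ?thesis by blast
qed

lemma neighbor_sym: "neighbor I C D \<longleftrightarrow> neighbor I D C"
  by (auto simp: neighbor_def)

lemma Gam_subset: "Gam I C \<subseteq> V"
  by (auto simp: Gam_def neighbor_def)

lemma finite_Gam: "finite (Gam I C)"
  using Gam_subset finite_V by (rule finite_subset)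

lemma wt_pos: "wt C > 0"
  using b_pos by (simp add: circuit_weight_def)

lemma up_prob_bounds: "0 \<le> up_prob C" "up_prob C \<le> 1"
  using wt_pos[of C] by (auto simp: up_prob_def field_simps)

lemma fun_upd_False_in_S: "s \<in> S \<Longrightarrow> C \<in> V \<Longrightarrow> s(C := False) \<in> S"
  by (auto simp: mem_S PiE_iff extensional_def)

text \<open>Raising \<open>C\<close> to 1 can create conflicts only in pairs that contain
  \<open>C\<close>. As \<open>neighbor\<close> is symmetric and irreflexive, these are the pairs of
  \<open>C\<close> with some \<open>D\<close> in \<open>Gam I C\<close>.\<close>

lemma fun_upd_True_in_S_iff:
  assumes "s \<in> S" "C \<in> V"
  shows "s(C := True) \<in> S \<longleftrightarrow> (\<forall>D \<in> Gam I C. \<not> s D)"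
proof
  assume "s(C := True) \<in> S"
  then have *: "\<forall>D. neighbor I C D \<longrightarrow> \<not> (s(C := True)) D"
    unfolding mem_S by (metis fun_upd_same)
  show "\<forall>D \<in> Gam I C. \<not> s D"
  proof (intro ballI)
    fix D assume D: "D \<in> Gam I C"
    then have "D \<noteq> C" by (auto simp: Gam_def neighbor_def)
    moreover have "\<not> (s(C := True)) D" using D * unfolding Gam_def by blast
    ultimately show "\<not> s D" by simp
  qed
next
  assume "\<forall>D \<in> Gam I C. \<not> s D"
  then have free: "\<not> s D" if "neighbor I C D" for D
    using that by (auto simp: Gam_def)
  have "\<not> (s(C := True)) D'" if D: "neighbor I D D'" "(s(C := True)) D" for D D'
  proof (cases "D = C \<or> D' = C")
    case True
    moreover have "D \<noteq> D'" using D(1) by (simp add: neighbor_def)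
    ultimately show ?thesis
      using D free neighbor_sym by (auto split: if_splits)
  next
    case False
    then show ?thesis using D assms(1) by (auto simp: mem_S)
  qed
  moreover have "s(C := True) \<in> V \<rightarrow>\<^sub>E UNIV"
    using assms by (auto simp: mem_S PiE_iff extensional_def)
  ultimately show "s(C := True) \<in> S"
    by (simp only: mem_S) blast
qed

section \<open>Updates of a single circuit and expectations along the chain\<close>

definition attempt :: "'v circuit_string \<Rightarrow> ('v \<times> var) set \<Rightarrow> bool \<Rightarrow> 'v circuit_string" where
  "attempt s C x = (if s(C := x) \<in> S then s(C := x) else s)"

lemma attempt_in_S: "s \<in> S \<Longrightarrow> attempt s C x \<in> S"
  by (simp add: attempt_def)

lemma attempt_False: "s \<in> S \<Longrightarrow> C \<in> V \<Longrightarrow> attempt s C False = s(C := False)"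
  by (simp add: attempt_def fun_upd_False_in_S)

text \<open>A blocked proposal leaves \<open>C\<close> at 0, so acceptance and rejection can both be
  written as assigning to \<open>C\<close> the truth value of being unblocked. This uniform form
  makes two states comparable after the same proposal.\<close>

lemma attempt_True:
  assumes "s \<in> S" "C \<in> V"
  shows "attempt s C True = s(C := (\<forall>D \<in> Gam I C. \<not> s D))"
proof (cases "s(C := True) \<in> S")
  case True
  then show ?thesis
    using fun_upd_True_in_S_iff[OF assms] by (simp add: attempt_def)
next
  case False
  \<comment> \<open>If \<open>C\<close> had value 1, the proposal would be \<open>s\<close> itself,
    which is a state.\<close>
  then have "\<not> s C"
    using assms(1) fun_upd_idem[of s C True] by auto
  then have "s(C := False) = s"
    by (simp add: fun_upd_idem)
  moreover have "(\<forall>D \<in> Gam I C. \<not> s D) = False"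
    using False fun_upd_True_in_S_iff[OF assms] by blast
  ultimately show ?thesis
    using False by (simp only: attempt_def if_False)
qed

lemma step_eq:
  "step I b ini s = bind_pmf (pmf_of_set V) (\<lambda>C.
     map_pmf (attempt s C) (bernoulli_pmf (up_prob C)))"
  by (simp add: step_def map_pmf_def attempt_def up_prob_def)

lemma set_step: "s \<in> S \<Longrightarrow> set_pmf (step I b ini s) \<subseteq> S"
  by (auto simp: step_eq attempt_in_S)

lemma set_steps: "s \<in> S \<Longrightarrow> set_pmf (steps I b ini t s) \<subseteq> S"
proof (induction t)
  case (Suc t)
  show ?case unfolding steps.simps set_bind_pmf
    by (intro UN_least set_step subsetD[OF Suc.IH[OF Suc.prems]])
qed simp

lemma expect_step:
  "expect (step I b ini s) f =
     (\<Sum>C\<in>V. up_prob C * f (attempt s C True) + (1 - up_prob C) * f (attempt s C False)) / card V"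
proof -
  have site: "expect (map_pmf (attempt s C) (bernoulli_pmf (up_prob C))) f
      = up_prob C * f (attempt s C True) + (1 - up_prob C) * f (attempt s C False)" for C
    by (simp add: up_prob_bounds)
  have "expect (step I b ini s) f =
      (\<Sum>C\<in>V. expect (map_pmf (attempt s C) (bernoulli_pmf (up_prob C))) f /\<^sub>R card V)"
    unfolding step_eq
    by (rule pmf_expectation_bind_pmf_of_set[OF V_nonempty finite_V]) simp
  also have "\<dots> = (\<Sum>C\<in>V. (up_prob C * f (attempt s C True)
      + (1 - up_prob C) * f (attempt s C False)) / card V)"
    by (simp only: site real_scaleR_def divide_inverse_commute)
  finally show ?thesis by (simp only: sum_divide_distrib)
qed

lemma expect_on_S:
  assumes "set_pmf M \<subseteq> S"
  shows "expect M f = (\<Sum>u\<in>S. pmf M u * f u)"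
  using assms by (subst integral_measure_pmf[of S]) (auto simp: finite_S)

text \<open>\<open>steps\<close> adds each new step at the end, so \<open>f\<close> is averaged over
  the last step first. Inductions on time therefore change the function and keep the initial
  state.\<close>

lemma expect_steps_Suc:
  fixes f :: "'v circuit_string \<Rightarrow> real"
  assumes "s \<in> S"
  shows "expect (steps I b ini (Suc t) s) f =
    expect (steps I b ini t s) (\<lambda>u. expect (step I b ini u) f)"
proof -
  have "expect (steps I b ini (Suc t) s) f =
      (\<Sum>u\<in>S. pmf (steps I b ini t s) u *\<^sub>R expect (step I b ini u) f)"
    unfolding steps.simps
    by (rule pmf_expectation_bind[OF finite_S _ set_steps[OF assms]])
      (rule finite_subset[OF set_step finite_S])
  then show ?thesis
    using set_steps[OF assms] by (simp add: expect_on_S)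
qed

section \<open>Stationarity of \<pi>\<close>

lemma string_weight_pos: "string_weight I b s > 0"
  unfolding string_weight_def by (intro prod_pos) (simp add: wt_pos)

lemma string_weight_upd:
  assumes "C \<in> V" "\<not> s C"
  shows "string_weight I b (s(C := True)) = wt C * string_weight I b s"
proof -
  have "{D. D \<in> V \<and> (s(C := True)) D} = insert C {D. D \<in> V \<and> s D}"
    using assms by auto
  then show ?thesis
    using assms finite_V by (simp add: string_weight_def)
qed

text \<open>For fixed \<open>C\<close> the update is a heat bath. Where \<open>C\<close> is blocked
  nothing changes. The remaining states form pairs that differ at \<open>C\<close> only, with
  weights in the ratio 1 to \<open>wt C\<close>, and the update resamples within each pair in this
  same ratio.\<close>

lemma site_update_invariant:
  assumes C: "C \<in> V"
  shows "(\<Sum>s\<in>S. string_weight I b s *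
      (up_prob C * f (attempt s C True) + (1 - up_prob C) * f (attempt s C False)))
    = (\<Sum>s\<in>S. string_weight I b s * f s)"
proof -
  define g where "g s = string_weight I b s *
    (up_prob C * f (attempt s C True) + (1 - up_prob C) * f (attempt s C False))" for s
  define h where "h s = string_weight I b s * f s" for s
  \<comment> \<open>\<open>A\<close> holds the states in which \<open>C\<close> is blocked,
    \<open>B\<close> those in which \<open>C\<close> is 0 but can be raised, and \<open>B'\<close>
    the partners of the latter, which turn out to be all states with \<open>C\<close> at 1.\<close>
  define A where "A = {s \<in> S. s(C := True) \<notin> S}"
  define B where "B = {s \<in> S. \<not> s C \<and> s(C := True) \<in> S}"
  define B' where "B' = (\<lambda>s. s(C := True)) ` B"
  have inj: "inj_on (\<lambda>s. s(C := True)) B"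
    by (rule inj_on_inverseI[where g = "\<lambda>s. s(C := False)"]) (simp add: B_def fun_upd_idem)
  have B': "B' = {s \<in> S. s C}"
  proof
    show "B' \<subseteq> {s \<in> S. s C}" by (auto simp: B'_def B_def)
    show "{s \<in> S. s C} \<subseteq> B'"
    proof
      fix s assume "s \<in> {s \<in> S. s C}"
      then have "s(C := False) \<in> B" "s = (s(C := False))(C := True)"
        using C by (auto simp: B_def fun_upd_False_in_S fun_upd_idem)
      then show "s \<in> B'" unfolding B'_def by (metis imageI)
    qed
  qed
  have S: "S = A \<union> (B \<union> B')"
    unfolding B' by (auto simp: A_def B_def)
  have disj: "A \<inter> (B \<union> B') = {}" "B \<inter> B' = {}"
    unfolding B' by (auto simp: A_def B_def fun_upd_idem)
  have fin: "finite A" "finite B" "finite B'"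
    using finite_S by (auto simp: A_def B_def B')
  have split: "sum k S = sum k A + (\<Sum>s\<in>B. k s + k (s(C := True)))" for k :: "_ \<Rightarrow> real"
  proof -
    have "sum k S = sum k A + (sum k B + sum k B')"
      unfolding S using fin disj by (simp add: sum.union_disjoint)
    also have "sum k B' = (\<Sum>s\<in>B. k (s(C := True)))"
      unfolding B'_def by (simp add: sum.reindex[OF inj])
    finally show ?thesis by (simp add: sum.distrib)
  qed
  have gA: "g s = h s" if "s \<in> A" for s
  proof -
    have "\<not> s C"
    proof
      assume "s C"
      then have "s(C := True) = s" by (simp add: fun_upd_idem)
      with that show False by (simp add: A_def)
    qed
    then have "attempt s C True = s" "attempt s C False = s"
      using that by (auto simp: A_def attempt_def fun_upd_idem)
    then show ?thesis by (simp add: g_def h_def algebra_simps)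
  qed
  have gB: "g s + g (s(C := True)) = h s + h (s(C := True))" if "s \<in> B" for s
  proof -
    have s: "s \<in> S" "\<not> s C" "s(C := True) \<in> S" using that by (auto simp: B_def)
    have *: "attempt s C True = s(C := True)" "attempt s C False = s"
      "attempt (s(C := True)) C True = s(C := True)" "attempt (s(C := True)) C False = s"
      using s by (auto simp: attempt_def fun_upd_idem)
    have upd: "string_weight I b (s(C := True)) = wt C * string_weight I b s"
      using C s(2) by (rule string_weight_upd)
    \<comment> \<open>Both states of the pair are sent to the same distribution on the pair, so
      their total weight \<open>(1 + wt C) * string_weight I b s\<close> is redistributed. These
      identities recover the two individual weights.\<close>
    have "up_prob C * (1 + wt C) = wt C" "(1 - up_prob C) * (1 + wt C) = 1"
      using wt_pos[of C] by (auto simp: up_prob_def field_simps)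
    moreover have "g s + g (s(C := True)) = string_weight I b s *
        ((up_prob C * (1 + wt C)) * f (s(C := True)) + ((1 - up_prob C) * (1 + wt C)) * f s)"
      unfolding g_def * upd by (simp only: algebra_simps)
    ultimately show ?thesis
      unfolding h_def upd by (simp add: algebra_simps)
  qed
  show ?thesis
    unfolding g_def[symmetric] h_def[symmetric] split using gA gB by simp
qed

lemma stationary_nonneg: "stationary I b ini s \<ge> 0"
  unfolding stationary_def
  by (intro divide_nonneg_nonneg sum_nonneg) (auto intro: less_imp_le string_weight_pos)

lemma sum_stationary: "(\<Sum>s\<in>S. stationary I b ini s) = 1"
proof -
  have "(\<Sum>s\<in>S. string_weight I b s) > 0"
    by (rule sum_pos) (use finite_S S_nonempty string_weight_pos in auto)
  then show ?thesis
    by (simp add: stationary_def flip: sum_divide_distrib)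
qed

text \<open>A step is a uniform mixture over \<open>C\<close> of updates that each preserve the
  unnormalized weights.\<close>

lemma stationary_step:
  "(\<Sum>s\<in>S. stationary I b ini s * expect (step I b ini s) f) = (\<Sum>s\<in>S. stationary I b ini s * f s)"
proof -
  define k where "k s C = up_prob C * f (attempt s C True) + (1 - up_prob C) * f (attempt s C False)"
    for s C
  have "(\<Sum>s\<in>S. string_weight I b s * expect (step I b ini s) f)
      = (\<Sum>s\<in>S. \<Sum>C\<in>V. string_weight I b s * k s C) / card V"
    by (simp add: expect_step k_def sum_distrib_left sum_divide_distrib)
  also have "\<dots> = (\<Sum>C\<in>V. \<Sum>s\<in>S. string_weight I b s * k s C) / card V"
    by (subst sum.swap) simp
  also have "\<dots> = (\<Sum>C\<in>V. \<Sum>s\<in>S. string_weight I b s * f s) / card V"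
    by (simp add: k_def site_update_invariant)
  also have "\<dots> = (\<Sum>s\<in>S. string_weight I b s * f s)"
    using card_V_pos by simp
  finally show ?thesis
    by (simp add: stationary_def flip: sum_divide_distrib)
qed

lemma stationary_steps:
  "(\<Sum>s\<in>S. stationary I b ini s * expect (steps I b ini t s) f)
    = (\<Sum>s\<in>S. stationary I b ini s * f s)"
proof (induction t arbitrary: f)
  case (Suc t)
  have "(\<Sum>s\<in>S. stationary I b ini s * expect (steps I b ini (Suc t) s) f)
      = (\<Sum>s\<in>S. stationary I b ini s *
          expect (steps I b ini t s) (\<lambda>u. expect (step I b ini u) f))"
    by (intro sum.cong) (simp_all add: expect_steps_Suc del: steps.simps)
  then show ?case by (simp add: Suc.IH stationary_step del: steps.simps)
qed simp

section \<open>Contraction of the Hamming distance in one step\<close>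

lemma finite_disagree: "finite (disagree s u)"
  using finite_V by (simp add: disagree_def)

lemma hamming_le_card: "hamming s u \<le> card V"
  by (auto simp: hamming_def disagree_def intro!: card_mono finite_V)

text \<open>States are extensional on \<open>V\<close>, so distinct ones differ at some circuit.
  This makes every bounded function on the states Lipschitz.\<close>

lemma hamming_ge_1:
  assumes "s \<in> S" "u \<in> S" "s \<noteq> u"
  shows "hamming s u \<ge> 1"
proof -
  have "disagree s u \<noteq> {}"
    using assms PiE_ext[of s V "\<lambda>_. UNIV" u] by (auto simp: disagree_def mem_S)
  then show ?thesis
    using finite_disagree[of s u] by (simp add: hamming_def Suc_leI card_gt_0_iff)
qed

lemma card_disagree_remove:
  "real (card (disagree s u - {C})) = hamming s u - of_bool (C \<in> disagree s u)"
proof (cases "C \<in> disagree s u")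
  case True
  then have "Suc (card (disagree s u - {C})) = card (disagree s u)"
    by (rule card_Suc_Diff1[OF finite_disagree])
  then have "real (card (disagree s u)) = real (card (disagree s u - {C})) + 1"
    by linarith
  moreover have "of_bool (C \<in> disagree s u) = (1 :: real)"
    using True by (simp only: of_bool_eq)
  ultimately show ?thesis unfolding hamming_def by linarith
qed (simp add: hamming_def)

lemma hamming_attempt_False:
  assumes "s \<in> S" "u \<in> S" "C \<in> V"
  shows "hamming (attempt s C False) (attempt u C False)
    = hamming s u - of_bool (C \<in> disagree s u)"
proof -
  have "disagree (s(C := False)) (u(C := False)) = disagree s u - {C}"
    by (auto simp: disagree_def)
  then show ?thesis
    by (simp only: attempt_False assms hamming_def[of "s(C := False)"] card_disagree_remove)
qed

text \<open>A disagreement at \<open>C\<close> after the update requires a disagreeing neighbor. The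
  indicator of this event is replaced by the number of such neighbors, because that number can be
  summed over \<open>C\<close> by double counting.\<close>

lemma hamming_attempt_True:
  assumes "s \<in> S" "u \<in> S" "C \<in> V"
  shows "hamming (attempt s C True) (attempt u C True)
    \<le> hamming s u - of_bool (C \<in> disagree s u) + card (Gam I C \<inter> disagree s u)"
proof -
  define x where "x = (\<forall>D \<in> Gam I C. \<not> s D)"
  define y where "y = (\<forall>D \<in> Gam I C. \<not> u D)"
  have diff: "disagree (s(C := x)) (u(C := y)) \<subseteq> (disagree s u - {C}) \<union> (if x = y then {} else {C})"
    by (auto simp: disagree_def)
  have "card (disagree (s(C := x)) (u(C := y)))
      \<le> card (disagree s u - {C}) + card (if x = y then {} else {C})"
    by (rule order.trans[OF card_mono[OF _ diff] card_Un_le]) (auto simp: finite_disagree)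
  moreover have "card (if x = y then {} else {C}) \<le> card (Gam I C \<inter> disagree s u)"
  proof (cases "x = y")
    case False
    then have "Gam I C \<inter> disagree s u \<noteq> {}"
      using Gam_subset[of C] by (auto simp: x_def y_def disagree_def)
    then show ?thesis
      using False finite_disagree[of s u] by (simp add: Suc_leI card_gt_0_iff)
  qed simp
  ultimately have "real (card (disagree (s(C := x)) (u(C := y))))
      \<le> real (card (disagree s u - {C})) + card (Gam I C \<inter> disagree s u)"
    by linarith
  then show ?thesis
    unfolding card_disagree_remove attempt_True[OF assms(1,3)] attempt_True[OF assms(2,3)]
      x_def[symmetric] y_def[symmetric]
    by (simp only: hamming_def)
qed

text \<open>Shrinking these constants under averaging over a step is the form, dual in the sense of
  Kantorovich, of contracting the Wasserstein distance for the Hamming metric.\<close>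

definition lipschitz :: "('v circuit_string \<Rightarrow> real) \<Rightarrow> real \<Rightarrow> bool" where
  "lipschitz f L \<longleftrightarrow> (\<forall>s\<in>S. \<forall>u\<in>S. \<bar>f s - f u\<bar> \<le> L * hamming s u)"

text \<open>Double counting of neighboring pairs \<open>C\<close>, \<open>D\<close> with
  \<open>D\<close> in disagreement: each \<open>D\<close> occurs with at most
  \<open>max_circuit_degree I\<close> circuits \<open>C\<close>, and each such \<open>C\<close> has
  the neighbor \<open>D\<close>, so its probability is at most \<open>q\<close>. The bound is asked
  only of circuits with a neighbor, since an isolated circuit has weight 1 and is set to 1 with
  probability 1/2, more than the \<open>q\<close> chosen later.\<close>

lemma sum_up_prob_disagree:
  fixes q :: real
  assumes q: "\<And>C. Gam I C \<noteq> {} \<Longrightarrow> up_prob C \<le> q" "q \<ge> 0"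
  shows "(\<Sum>C\<in>V. up_prob C * card (Gam I C \<inter> disagree s u))
    \<le> max_circuit_degree I * q * hamming s u"
proof -
  let ?R = "disagree s u"
  have "(\<Sum>C\<in>V. up_prob C * card (Gam I C \<inter> ?R))
      = (\<Sum>C\<in>V. \<Sum>D\<in>?R. of_bool (neighbor I C D) * up_prob C)"
  proof (rule sum.cong[OF refl])
    fix C
    have "Gam I C \<inter> ?R = {D \<in> ?R. neighbor I C D}" by (auto simp: Gam_def)
    then have "real (card (Gam I C \<inter> ?R)) = (\<Sum>D\<in>?R. of_bool (neighbor I C D))"
      using finite_disagree[of s u]
      by (simp add: Collect_conj_eq Int_commute)
    then show "up_prob C * card (Gam I C \<inter> ?R)
        = (\<Sum>D\<in>?R. of_bool (neighbor I C D) * up_prob C)"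
      by (simp only: sum_distrib_left mult.commute)
  qed
  also have "\<dots> = (\<Sum>D\<in>?R. \<Sum>C\<in>V. of_bool (neighbor I C D) * up_prob C)"
    by (rule sum.swap)
  also have "\<dots> \<le> (\<Sum>D\<in>?R. max_circuit_degree I * q)"
  proof (rule sum_mono)
    fix D assume "D \<in> ?R"
    then have D: "D \<in> V" by (simp add: disagree_def)
    have "(\<Sum>C\<in>V. of_bool (neighbor I C D) * up_prob C)
        \<le> (\<Sum>C\<in>V. of_bool (C \<in> Gam I D) * q)"
      using q(1) by (intro sum_mono) (auto simp: Gam_def neighbor_sym)
    also have "\<dots> = card (Gam I D) * q"
      using finite_V Gam_subset[of D]
      by (simp add: flip: sum_distrib_right) (simp add: Int_absorb1)
    also have "\<dots> \<le> max_circuit_degree I * q"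
      using D finite_V q(2)
      by (intro mult_right_mono)
        (auto simp: max_circuit_degree_def circuit_degree_def intro!: Max_ge)
    finally show "(\<Sum>C\<in>V. of_bool (neighbor I C D) * up_prob C) \<le> max_circuit_degree I * q" .
  qed
  finally show ?thesis by (simp add: hamming_def mult_ac)
qed

text \<open>A common proposal at a uniformly chosen circuit removes on average
  \<open>hamming s u / card V\<close> old disagreements and adds at most
  \<open>max_circuit_degree I * q * hamming s u / card V\<close> new ones.\<close>

lemma lipschitz_step:
  fixes q :: real
  assumes q: "\<And>C. Gam I C \<noteq> {} \<Longrightarrow> up_prob C \<le> q" "q \<ge> 0"
    and L: "L \<ge> 0" "lipschitz f L"
  shows "lipschitz (\<lambda>s. expect (step I b ini s) f)
    (L * (1 - (1 - max_circuit_degree I * q) / card V))"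
  unfolding lipschitz_def
proof (intro ballI)
  fix s u assume su: "s \<in> S" "u \<in> S"
  let ?R = "disagree s u" and ?h = "hamming s u" and ?n = "real (card V)"
  define k where "k s C = up_prob C * f (attempt s C True) + (1 - up_prob C) * f (attempt s C False)"
    for s C
  have site: "\<bar>k s C - k u C\<bar>
      \<le> L * (?h - of_bool (C \<in> ?R) + up_prob C * card (Gam I C \<inter> ?R))" if C: "C \<in> V" for C
  proof -
    have lip: "\<bar>f (attempt s C x) - f (attempt u C x)\<bar>
        \<le> L * hamming (attempt s C x) (attempt u C x)" for x
      using L(2) su by (simp add: lipschitz_def attempt_in_S)
    have T: "\<bar>f (attempt s C True) - f (attempt u C True)\<bar>
        \<le> L * (?h - of_bool (C \<in> ?R) + card (Gam I C \<inter> ?R))"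
      by (rule order.trans[OF lip mult_left_mono[OF hamming_attempt_True[OF su C] L(1)]])
    have F: "\<bar>f (attempt s C False) - f (attempt u C False)\<bar> \<le> L * (?h - of_bool (C \<in> ?R))"
      using lip[of False] by (simp only: hamming_attempt_False[OF su C])
    \<comment> \<open>Equal proposed values are compared with each other: this is the coupling,
      carried out inside the expectation.\<close>
    have "k s C - k u C = up_prob C * (f (attempt s C True) - f (attempt u C True))
        + (1 - up_prob C) * (f (attempt s C False) - f (attempt u C False))"
      unfolding k_def by algebra
    then have "\<bar>k s C - k u C\<bar> = \<bar>up_prob C * (f (attempt s C True) - f (attempt u C True))
        + (1 - up_prob C) * (f (attempt s C False) - f (attempt u C False))\<bar>"
      by (rule arg_cong)
    also have "\<dots> \<le> \<bar>up_prob C * (f (attempt s C True) - f (attempt u C True))\<bar>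
        + \<bar>(1 - up_prob C) * (f (attempt s C False) - f (attempt u C False))\<bar>"
      by (rule abs_triangle_ineq)
    also have "\<dots> = up_prob C * \<bar>f (attempt s C True) - f (attempt u C True)\<bar>
        + (1 - up_prob C) * \<bar>f (attempt s C False) - f (attempt u C False)\<bar>"
      using up_prob_bounds[of C] by (simp only: abs_mult abs_of_nonneg diff_ge_0_iff_ge)
    also have "\<dots> \<le> up_prob C * (L * (?h - of_bool (C \<in> ?R) + card (Gam I C \<inter> ?R)))
        + (1 - up_prob C) * (L * (?h - of_bool (C \<in> ?R)))"
      using up_prob_bounds[of C] by (intro add_mono mult_left_mono T F) auto
    also have "\<dots> = L * (?h - of_bool (C \<in> ?R) + up_prob C * card (Gam I C \<inter> ?R))"
      by (simp only: algebra_simps)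
    finally show ?thesis .
  qed
  have R: "(\<Sum>C\<in>V. of_bool (C \<in> ?R)) = ?h"
    using finite_V by (simp add: hamming_def) (metis (no_types, lifting) Int_absorb1 disagree_def mem_Collect_eq subsetI)
  have "\<bar>(\<Sum>C\<in>V. k s C) - (\<Sum>C\<in>V. k u C)\<bar> \<le> (\<Sum>C\<in>V. \<bar>k s C - k u C\<bar>)"
    by (simp add: sum_subtractf[symmetric])
  also have "\<dots> \<le> (\<Sum>C\<in>V. L * (?h - of_bool (C \<in> ?R) + up_prob C * card (Gam I C \<inter> ?R)))"
    by (intro sum_mono site)
  also have "\<dots> = L * (?n * ?h - ?h + (\<Sum>C\<in>V. up_prob C * card (Gam I C \<inter> ?R)))"
    by (simp add: sum_distrib_left[symmetric] sum.distrib sum_subtractf R del: sum_of_bool_eq)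
  also have "\<dots> \<le> L * (?n * ?h - ?h + max_circuit_degree I * q * ?h)"
    using L(1) sum_up_prob_disagree[OF q] by (intro mult_left_mono add_left_mono) auto
  finally have "\<bar>(\<Sum>C\<in>V. k s C) - (\<Sum>C\<in>V. k u C)\<bar> / ?n
      \<le> L * (?n * ?h - ?h + max_circuit_degree I * q * ?h) / ?n"
    by (rule divide_right_mono) simp
  also have "\<dots> = L * (1 - (1 - max_circuit_degree I * q) / ?n) * ?h"
    using card_V_pos by (simp add: field_simps)
  finally show "\<bar>expect (step I b ini s) f - expect (step I b ini u) f\<bar>
      \<le> L * (1 - (1 - max_circuit_degree I * q) / card V) * ?h"
    using card_V_pos by (simp add: expect_step k_def flip: diff_divide_distrib)
qed

section \<open>Total variation distance and mixing time\<close>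

lemma tv_dist_le:
  fixes q \<rho> :: real
  assumes q: "\<And>C. Gam I C \<noteq> {} \<Longrightarrow> up_prob C \<le> q" "q \<ge> 0" and s: "s \<in> S"
  defines "\<rho> \<equiv> 1 - (1 - max_circuit_degree I * q) / card V"
  shows "tv_dist I b ini s t \<le> card V * \<rho> ^ t"
proof -
  \<comment> \<open>A nonnegative rate keeps the Lipschitz constants nonnegative throughout the
    induction.\<close>
  have "(1 - max_circuit_degree I * q) / card V \<le> 1"
    using card_V_pos q(2) by (simp add: field_simps add_increasing2)
  then have \<rho>: "\<rho> \<ge> 0" by (simp add: \<rho>_def)
  have contract: "lipschitz (\<lambda>s. expect (steps I b ini t s) f) (L * \<rho> ^ t)"
    if "L \<ge> 0" "lipschitz f L" for f L
    using that
  proof (induction t arbitrary: f L)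
    case (Suc t)
    have "lipschitz (\<lambda>s. expect (steps I b ini t s) (\<lambda>u. expect (step I b ini u) f))
        (L * \<rho> * \<rho> ^ t)"
      using lipschitz_step[OF q Suc.prems] \<rho> Suc.prems(1) by (intro Suc.IH) (auto simp: \<rho>_def)
    then show ?case
      by (simp add: lipschitz_def expect_steps_Suc mult.assoc del: steps.simps)
  qed simp
  define \<pi> where "\<pi> = stationary I b ini"
  \<comment> \<open>The sign of the difference between the law at time \<open>t\<close> from
    \<open>s\<close> and \<pi>; testing against it yields the whole L1 distance. It stays tied to
    \<open>s\<close>, while \<open>E\<close> lets the initial state vary.\<close>
  define f :: "'v circuit_string \<Rightarrow> real"
    where "f u = (if pmf (steps I b ini t s) u \<ge> \<pi> u then 1 else - 1)" for u
  define E where "E u = expect (steps I b ini t u) f" for u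
  \<comment> \<open>The values are 1 and -1, and distinct states are at distance at least 1. The
    resulting 2 cancels against the factor 1/2 in \<open>tv_dist\<close>.\<close>
  have "lipschitz f 2"
    unfolding lipschitz_def
  proof (intro ballI)
    fix v u assume "v \<in> S" "u \<in> S"
    then show "\<bar>f v - f u\<bar> \<le> 2 * hamming v u"
      using hamming_ge_1[of v u] by (cases "v = u") (auto simp: f_def hamming_def)
  qed
  then have lip: "lipschitz E (2 * \<rho> ^ t)"
    unfolding E_def by (intro contract) auto
  have close: "E s - E u \<le> 2 * \<rho> ^ t * card V" if "u \<in> S" for u
  proof -
    have "E s - E u \<le> 2 * \<rho> ^ t * hamming s u"
      using lip s that by (force simp: lipschitz_def)
    also have "\<dots> \<le> 2 * \<rho> ^ t * card V"
      using \<rho> hamming_le_card by (intro mult_left_mono) auto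
    finally show ?thesis .
  qed
  have "(\<Sum>u\<in>S. \<bar>pmf (steps I b ini t s) u - \<pi> u\<bar>)
      = (\<Sum>u\<in>S. pmf (steps I b ini t s) u * f u - \<pi> u * f u)"
    by (intro sum.cong) (auto simp: f_def)
  also have "\<dots> = E s - (\<Sum>u\<in>S. \<pi> u * f u)"
    by (simp add: sum_subtractf E_def expect_on_S[OF set_steps[OF s]])
  \<comment> \<open>Stationarity replaces \<open>f\<close> under \<pi> by its average
    \<open>E\<close> over \<open>t\<close> steps, and total mass 1 turns \<open>E s\<close> into a
    \<pi>-average. What remains compares two initial states.\<close>
  also have "\<dots> = (\<Sum>u\<in>S. \<pi> u * E s) - (\<Sum>u\<in>S. \<pi> u * E u)"
    using sum_stationary
    by (simp add: \<pi>_def E_def stationary_steps flip: sum_distrib_right)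
  also have "\<dots> = (\<Sum>u\<in>S. \<pi> u * (E s - E u))"
    by (simp add: sum_subtractf right_diff_distrib)
  also have "\<dots> \<le> (\<Sum>u\<in>S. \<pi> u * (2 * \<rho> ^ t * card V))"
    by (intro sum_mono mult_left_mono close) (auto simp: \<pi>_def stationary_nonneg)
  also have "\<dots> = 2 * \<rho> ^ t * card V"
    using sum_stationary by (simp add: \<pi>_def flip: sum_distrib_right)
  finally show ?thesis
    by (simp add: tv_dist_def \<pi>_def mult_ac)
qed

lemma mixing_time_le:
  assumes "\<And>s t. s \<in> S \<Longrightarrow> t \<ge> T \<Longrightarrow> tv_dist I b ini s t \<le> \<epsilon>"
  shows "mixing_time I b ini \<epsilon> \<le> enat T"
  unfolding mixing_time_def
  by (subst Max_le_iff) (use assms in \<open>auto simp: finite_S S_nonempty intro!: INF_lower2[of T]\<close>)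

lemma mixing_time_bound:
  fixes \<epsilon> \<beta> :: real and n \<delta> :: nat
  assumes n: "n = card V" and \<delta>: "\<delta> = max_circuit_degree I" "\<delta> \<ge> 2"
    and \<beta>: "\<beta> = real_of_rat b" "\<beta> \<le> 1 / real \<delta>" and \<epsilon>: "0 < \<epsilon>" "\<epsilon> < 1"
  shows "ereal_of_enat (mixing_time I b ini \<epsilon>)
    \<le> ereal (3 * (real n * (1 + \<beta> ^ \<delta>) / (\<beta> ^ \<delta> + 1 - \<beta> * real \<delta>) * ln (real n * real \<delta> / \<epsilon>)))"
proof -
  \<comment> \<open>\<open>q\<close> bounds the probability of setting to 1 a circuit that has a
    neighbor, \<open>\<kappa> / n\<close> is the resulting contraction per step, and at time
    \<open>x\<close> the factor \<open>exp (- \<kappa> * x / n)\<close> equals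
    \<open>\<epsilon> / (n * \<delta>)\<close>.\<close>
  define q where "q = \<beta> / (1 + \<beta> ^ \<delta>)"
  define \<kappa> where "\<kappa> = 1 - \<delta> * q"
  define x where "x = n / \<kappa> * ln (real n * real \<delta> / \<epsilon>)"
  have b0: "\<beta> > 0" using \<beta>(1) b_pos by simp
  have b\<delta>: "\<beta> * \<delta> \<le> 1" using \<beta>(2) \<delta>(2) by (simp add: field_simps)
  have "\<beta> * 1 \<le> \<beta> * \<delta>" using b0 \<delta>(2) by (intro mult_left_mono) auto
  with b\<delta> have b1: "\<beta> \<le> 1" by linarith
  have pw: "\<beta> ^ \<delta> > 0" using b0 by simp
  have q0: "q \<ge> 0" using b0 pw by (simp add: q_def)
  have q: "up_prob C \<le> q" if "Gam I C \<noteq> {}" for C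
  proof -
    have d: "circuit_degree I C \<ge> 1"
      using that finite_Gam[of C] by (simp add: circuit_degree_def Suc_leI card_gt_0_iff)
    have "\<beta> ^ circuit_degree I C \<le> \<beta> ^ 1"
      using b0 b1 d by (intro power_decreasing) auto
    then have w: "wt C \<le> \<beta>" by (simp add: circuit_weight_def \<beta>(1))
    have "up_prob C \<le> \<beta> / (1 + \<beta>)"
      using w wt_pos[of C] b0 by (simp add: up_prob_def field_simps)
    \<comment> \<open>Since \<open>\<beta> ^ \<delta> \<le> \<beta>\<close>. This weakening gives
      the rate the denominator of the stated bound.\<close>
    also have "\<dots> \<le> q"
      unfolding q_def using b0 b1 pw power_decreasing[of 1 \<delta> \<beta>] \<delta>(2)
      by (intro divide_left_mono mult_pos_pos add_pos_pos) auto
    finally show ?thesis .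
  qed
  have \<kappa>_eq: "\<kappa> = (\<beta> ^ \<delta> + 1 - \<beta> * \<delta>) / (1 + \<beta> ^ \<delta>)"
    using pw by (simp add: \<kappa>_def q_def field_simps)
  have \<kappa>: "0 < \<kappa>" "\<kappa> \<le> 1"
    using pw b\<delta> q0 by (simp add: \<kappa>_eq) (simp add: \<kappa>_def q0)
  have n1: "real n \<ge> 1" using card_V_pos n by simp
  \<comment> \<open>This keeps the logarithm at least \<open>ln 2\<close>, so \<open>x\<close> is
    bounded away from 0 and rounding it up costs only a constant factor.\<close>
  have "2 * \<epsilon> \<le> real n * real \<delta>"
    using mult_mono[of 1 "real n" 2 "real \<delta>"] n1 \<delta>(2) \<epsilon> by simp
  then have arg: "real n * \<delta> / \<epsilon> \<ge> 2" using \<epsilon> by (simp add: field_simps)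
  then have "ln (real n * \<delta> / \<epsilon>) \<ge> ln 2" by simp
  then have ln_ge: "ln (real n * \<delta> / \<epsilon>) \<ge> 1 / 2" using ln2_ge_two_thirds by linarith
  have "real n / \<kappa> \<ge> 1" using n1 \<kappa> by (simp add: field_simps)
  then have "1 * (1 / 2) \<le> x" unfolding x_def using ln_ge by (intro mult_mono) auto
  then have x: "x \<ge> 1 / 2" by simp
  \<comment> \<open>For \<open>x \<ge> 1 / 2\<close> the ceiling of \<open>x\<close> is at most
    \<open>x + 1 \<le> 3 * x\<close>, which is where the absolute constant 3 comes from.\<close>
  define T where "T = nat \<lceil>x\<rceil>"
  have T: "x \<le> real T" "real T \<le> 3 * x" using x unfolding T_def by linarith+
  have "mixing_time I b ini \<epsilon> \<le> enat T"
  proof (rule mixing_time_le)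
    fix s t assume s: "s \<in> S" and t: "t \<ge> T"
    \<comment> \<open>The base \<open>1 - \<kappa> / n\<close> must be nonnegative before its power
      can be compared with that of the exponential.\<close>
    have kn: "\<kappa> / n \<le> 1" using n1 \<kappa> by (simp add: field_simps)
    have "tv_dist I b ini s t \<le> n * (1 - \<kappa> / n) ^ t"
      using tv_dist_le[OF q q0 s, of t] by (simp add: n \<delta>(1) \<kappa>_def)
    also have "\<dots> \<le> n * exp (- (\<kappa> / n)) ^ t"
      using kn exp_ge_add_one_self[of "- (\<kappa> / n)"] by (intro mult_left_mono power_mono) auto
    also have "\<dots> = n * exp (- (\<kappa> / n * t))"
      by (simp add: exp_of_nat_mult[symmetric] mult.commute)
    also have "\<dots> \<le> n * exp (- ln (real n * real \<delta> / \<epsilon>))"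
    proof -
      have "ln (real n * real \<delta> / \<epsilon>) = \<kappa> / n * x" using \<kappa> n1 by (simp add: x_def)
      also have "\<dots> \<le> \<kappa> / n * t"
        using T(1) t \<kappa> by (intro mult_left_mono) auto
      finally show ?thesis by (intro mult_left_mono) simp_all
    qed
    also have "\<dots> = \<epsilon> / \<delta>"
      using arg n1 \<epsilon> \<delta>(2) by (simp add: exp_minus field_simps)
    also have "\<dots> \<le> \<epsilon>"
      using \<epsilon> \<delta>(2) by (simp add: field_simps)
    finally show "tv_dist I b ini s t \<le> \<epsilon>" .
  qed
  then have "ereal_of_enat (mixing_time I b ini \<epsilon>) \<le> ereal_of_enat (enat T)"
    by (simp only: ereal_of_enat_le_iff)
  also have "\<dots> \<le> ereal (3 * x)" using T(2) by simp
  also have "x = n * (1 + \<beta> ^ \<delta>) / (\<beta> ^ \<delta> + 1 - \<beta> * \<delta>) * ln (real n * real \<delta> / \<epsilon>)"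
    by (simp add: x_def \<kappa>_eq)
  finally show ?thesis .
qed

end

theorem theorem5:
  shows "\<exists>c::real. c > 0 \<and>
    (\<forall>(I :: ('v, 'e) six_vertex) (b :: rat) (ini :: ('v \<times> var) set \<Rightarrow> 'v \<times> var) (\<epsilon> :: real)
        (n :: nat) (\<delta> :: nat) (\<beta> :: real).
       six_vertex_instance I \<longrightarrow>
       b > 0 \<longrightarrow>
       initial_edges I ini \<longrightarrow>
       standing_identification I b ini \<longrightarrow>
       two_by_two_intersection_free I \<longrightarrow>
       n = card (circuits I) \<longrightarrow>
       \<delta> = max_circuit_degree I \<longrightarrow>
       \<beta> = real_of_rat b \<longrightarrow>
       \<delta> \<ge> 2 \<longrightarrow>
       \<beta> \<le> 1 / real \<delta> \<longrightarrow>
       0 < \<epsilon> \<longrightarrow> \<epsilon> < 1 \<longrightarrow>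
       ereal_of_enat (mixing_time I b ini \<epsilon>)
         \<le> ereal (c * (real n * (1 + \<beta> ^ \<delta>) / (\<beta> ^ \<delta> + 1 - \<beta> * real \<delta>)
                        * ln (real n * real \<delta> / \<epsilon>))))"
proof (intro exI[of _ 3] conjI allI impI)
  fix I :: "('v, 'e) six_vertex" and b :: rat and ini :: "('v \<times> var) set \<Rightarrow> 'v \<times> var"
    and \<epsilon> \<beta> :: real and n \<delta> :: nat
  assume "six_vertex_instance I" "b > 0" "standing_identification I b ini"
  then interpret circuit_chain I b ini by unfold_locales
  assume "n = card (circuits I)" "\<delta> = max_circuit_degree I" "\<beta> = real_of_rat b" "\<delta> \<ge> 2"
    "\<beta> \<le> 1 / real \<delta>" "0 < \<epsilon>" "\<epsilon> < 1"
  then show "ereal_of_enat (mixing_time I b ini \<epsilon>)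
      \<le> ereal (3 * (real n * (1 + \<beta> ^ \<delta>) / (\<beta> ^ \<delta> + 1 - \<beta> * real \<delta>)
                     * ln (real n * real \<delta> / \<epsilon>)))"
    by (intro mixing_time_bound)
qed simp

end
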